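(* For every integer $n \geq 2$, the complete graph $K_n$ on $n$ vertices satisfies $cr(K_n) \leq 3n$.
   Context: Graphs are simple, undirected and labelled. A bicoloration of a graph $G=(V,E)$ is a mapping $\beta:V\to\{-1,1\}$, and a bicolored graph on $G$ is a pair $B=(G,\beta)$. Two bicolored graphs on the same vertex set are equal if they have the same edge set and the same coloring. $N_G(a)$ denotes the open neighborhood of $a$. For $a\in V$, the local complement $G_a$ is the graph on $V$ obtained from $G$ by toggling adjacency between every pair of distinct vertices of $N_G(a)$ (all other adjacencies are unchanged). The coloring $\beta_a$ is given by $\beta_a(x)=-\beta(x)$ if $x\in N_G(a)$ and $\beta_a(x)=\beta(x)$ otherwise. The local inversion of $B$ at $a$ is $B_a=(G_a,\beta_a)$. For a string $w\in V^*$ (a finite sequence of vertices, with length $|w|$), $B_w$ is defined inductively by $B_\varepsilon=B$ for the empty string $\varepsilon$, and $B_{w'a}=(B_{w'})_a$. For $A\subseteq V$, $B^{A}$ denotes the bicolored graph with the same underlying graph $G$ in which the colors of exactly the vertices in $A$ are flipped (multiplied by $-1$). The color reversal number $cr(G)$ is the minimum $\ell$ such that for every bicoloration $\beta$ of $G$, with $B=(G,\beta)$, there exists a string $w\in V^*$ with $|w|\le \ell$ and $B_w=B^{V}$. An inequality $cr(G)\le N$ includes the assertion that such an $\ell$ exists. *)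

theory Defs
  imports
    "Graph_Theory.Kuratowski"
    "HOL-Library.Extended_Nat"
    "HOL-Library.FuncSet"
begin

text \<open>
  Simple undirected graphs are elements of the locale \<^locale>\<open>pair_graph\<close>: finite, symmetric,
  loop-free relations on a vertex set. The predicate \<^const>\<open>complete_digraph\<close>, written
  \<open>K\<^bsub>n\<^esub> G\<close>, says that \<open>G\<close> is a complete graph on \<open>n\<close> vertices.

  Colorings are extensional functions, so that HOL equality of bicolored graphs is equality of the
  vertex sets, of the edge sets, and of the colorings on the vertices.
\<close>

type_synonym 'a bicolored_graph = "'a pair_pre_digraph \<times> ('a \<Rightarrow> int)"

definition bicolorations :: "'a pair_pre_digraph \<Rightarrow> ('a \<Rightarrow> int) set" where
  "bicolorations G = pverts G \<rightarrow>\<^sub>E {-1, 1}"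

definition open_nbhd :: "'a pair_pre_digraph \<Rightarrow> 'a \<Rightarrow> 'a set" where
  "open_nbhd G a = {x. (a, x) \<in> parcs G}"

definition local_complement :: "'a pair_pre_digraph \<Rightarrow> 'a \<Rightarrow> 'a pair_pre_digraph" where
  "local_complement G a = G\<lparr>parcs :=
     {(x, y). if x \<in> open_nbhd G a \<and> y \<in> open_nbhd G a \<and> x \<noteq> y
              then (x, y) \<notin> parcs G else (x, y) \<in> parcs G}\<rparr>"

definition flip_colors :: "'a set \<Rightarrow> ('a \<Rightarrow> int) \<Rightarrow> 'a \<Rightarrow> int" where
  "flip_colors A \<beta> = (\<lambda>x. if x \<in> A then - \<beta> x else \<beta> x)"

definition local_inversion :: "'a bicolored_graph \<Rightarrow> 'a \<Rightarrow> 'a bicolored_graph" where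
  "local_inversion B a =
     (local_complement (fst B) a, flip_colors (open_nbhd (fst B) a) (snd B))"

definition local_inversions :: "'a bicolored_graph \<Rightarrow> 'a list \<Rightarrow> 'a bicolored_graph" where
  "local_inversions B w = foldl local_inversion B w"

definition color_flip :: "'a bicolored_graph \<Rightarrow> 'a set \<Rightarrow> 'a bicolored_graph" where
  "color_flip B A = (fst B, flip_colors A (snd B))"

definition reverses_within :: "'a pair_pre_digraph \<Rightarrow> nat \<Rightarrow> bool" where
  "reverses_within G l \<longleftrightarrow>
     (\<forall>\<beta> \<in> bicolorations G. \<exists>w \<in> lists (pverts G).
        length w \<le> l \<and> local_inversions (G, \<beta>) w = color_flip (G, \<beta>) (pverts G))"

text \<open>
  The minimum is taken in \<^typ>\<open>enat\<close>, where the infimum of the empty set is \<open>\<infinity>\<close>; hence a finite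
  upper bound entails that the minimum exists (see \<open>color_reversal_number_le_iff\<close>).
\<close>

definition color_reversal_number :: "'a pair_pre_digraph \<Rightarrow> enat" where
  "color_reversal_number G = (INF l \<in> {l. reverses_within G l}. enat l)"

lemma reverses_within_mono: "reverses_within G l \<Longrightarrow> l \<le> m \<Longrightarrow> reverses_within G m"
  unfolding reverses_within_def by (meson order_trans)

lemma color_reversal_number_le_iff:
  "color_reversal_number G \<le> enat N \<longleftrightarrow> reverses_within G N"
proof
  assume "reverses_within G N"
  then show "color_reversal_number G \<le> enat N"
    unfolding color_reversal_number_def by (auto intro: INF_lower)
next
  assume "color_reversal_number G \<le> enat N"
  then have "(INF l \<in> {l. reverses_within G l}. enat l) < enat (Suc N)"
    unfolding color_reversal_number_def by (rule le_less_trans) simp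
  then obtain l where "reverses_within G l" "enat l < enat (Suc N)"
    unfolding INF_less_iff by auto
  then show "reverses_within G N"
    by (auto intro: reverses_within_mono)
qed

lemma pair_graph_local_complement:
  assumes "pair_graph G"
  shows "pair_graph (local_complement G a)"
proof -
  interpret pair_graph G by fact
  have nb: "open_nbhd G a \<subseteq> pverts G"
    by (auto simp: open_nbhd_def dest: in_arcsD2)
  have sub: "parcs (local_complement G a) \<subseteq> pverts G \<times> pverts G"
    using nb by (auto simp: local_complement_def dest: in_arcsD1 in_arcsD2 split: if_splits)
  have verts: "pverts (local_complement G a) = pverts G"
    by (simp add: local_complement_def)
  have fin: "finite (parcs (local_complement G a))"
    using sub by (rule finite_subset) (simp add: pair_finite_verts)
  have sym: "symmetric (with_proj (local_complement G a))"
    by (auto simp: symmetric_def local_complement_def intro!: symI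
        intro: arcs_symmetric split: if_splits)
  have loopfree: "fst e \<noteq> snd e" if "e \<in> parcs (local_complement G a)" for e
    using that pair_no_loops by (auto simp: local_complement_def split: if_splits)
  show ?thesis
    using sub fin sym loopfree by unfold_locales (auto simp: verts pair_finite_verts)
qed

lemma bicolorations_local_inversion:
  assumes "pair_graph G" "\<beta> \<in> bicolorations G"
  shows "snd (local_inversion (G, \<beta>) a) \<in> bicolorations (local_complement G a)"
proof -
  interpret pair_graph G by fact
  have "open_nbhd G a \<subseteq> pverts G"
    by (auto simp: open_nbhd_def dest: in_arcsD2)
  then show ?thesis
    using assms(2)
    by (fastforce simp: local_inversion_def bicolorations_def flip_colors_def local_complement_def
        PiE_iff extensional_def)
qed

end

theory Submission
  imports Defs
begin

text \<open>
  In a complete graph the color of a single vertex \<open>a\<close> can be flipped by three local inversions that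
  leave the graph as it was. Local complementation at \<open>a\<close> turns the complete graph into the star with
  center \<open>a\<close> and turns this star back into the complete graph, and both moves flip every vertex except
  \<open>a\<close>. If one inverts at a leaf \<open>b\<close> in between, the star does not change, because \<open>b\<close> has the single
  neighbor \<open>a\<close>, and only \<open>a\<close> is flipped. So the word \<open>a b a\<close> flips exactly \<open>a\<close>. A leaf exists as
  soon as there are two vertices, and treating the \<open>n\<close> vertices one after the other takes \<open>3 * n\<close> steps
  (lemma \<open>reverse_colors_one_by_one\<close>), whatever the initial coloring is.
\<close>

lemma local_inversions_append:
  "local_inversions B (v @ w) = local_inversions (local_inversions B v) w"
  by (simp add: local_inversions_def)

lemma flip_colors_flip_colors:
  "flip_colors A (flip_colors B \<beta>) = flip_colors ((A - B) \<union> (B - A)) \<beta>"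
  by (auto simp: flip_colors_def)

lemma parcs_complete:
  assumes "K\<^bsub>n\<^esub> (with_proj G)"
  shows "parcs G = {(x, y). x \<in> pverts G \<and> y \<in> pverts G \<and> x \<noteq> y}"
  using assms by (simp add: complete_digraph_def)

lemma open_nbhd_complete:
  assumes "K\<^bsub>n\<^esub> (with_proj G)" and "a \<in> pverts G"
  shows "open_nbhd G a = pverts G - {a}"
  using assms(2) by (auto simp: open_nbhd_def parcs_complete[OF assms(1)])

lemma parcs_local_complement_complete:
  assumes "K\<^bsub>n\<^esub> (with_proj G)" and "a \<in> pverts G"
  shows "parcs (local_complement G a) =
    {(x, y). x \<in> pverts G \<and> y \<in> pverts G \<and> x \<noteq> y \<and> (x = a \<or> y = a)}"
  using assms(2)
  by (auto simp: local_complement_def open_nbhd_complete[OF assms] parcs_complete[OF assms(1)])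

lemma open_nbhd_local_complement_same:
  assumes "(a, a) \<notin> parcs G"
  shows "open_nbhd (local_complement G a) a = open_nbhd G a"
  using assms by (auto simp: open_nbhd_def local_complement_def)

lemma local_complement_involutive:
  assumes "(a, a) \<notin> parcs G"
  shows "local_complement (local_complement G a) a = G"
proof -
  have "parcs (local_complement (local_complement G a) a) = parcs G"
    unfolding local_complement_def[of "local_complement G a"]
      open_nbhd_local_complement_same[OF assms]
    by (auto simp: local_complement_def)
  then show ?thesis
    by (simp add: local_complement_def)
qed

text \<open>A single neighbor leaves no pair of neighbors to toggle.\<close>

lemma local_complement_at_leaf:
  assumes "open_nbhd H b = {a}"
  shows "local_complement H b = H"
proof -
  have "parcs (local_complement H b) = parcs H"
    by (auto simp: local_complement_def assms)
  then show ?thesis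
    by (simp add: local_complement_def)
qed

text \<open>
  In the word \<open>a b a\<close> the two inversions at the center \<open>a\<close> undo each other, both on the edges and on
  the colors of the vertices other than \<open>a\<close>; what survives is the inversion at the leaf \<open>b\<close>.
\<close>

lemma flip_single_color:
  assumes K: "K\<^bsub>n\<^esub> (with_proj G)" and ab: "a \<in> pverts G" "b \<in> pverts G" "a \<noteq> b"
  shows "local_inversions (G, \<beta>) [a, b, a] = (G, flip_colors {a} \<beta>)"
proof -
  let ?S = "local_complement G a"
  have no_loop: "(a, a) \<notin> parcs G"
    by (simp add: parcs_complete[OF K])
  have leaf: "open_nbhd ?S b = {a}"
    using ab by (auto simp: open_nbhd_def parcs_local_complement_complete[OF K ab(1)])
  have center: "open_nbhd ?S a = pverts G - {a}" "local_complement ?S a = G"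
    by (simp_all add: open_nbhd_local_complement_same local_complement_involutive no_loop
        open_nbhd_complete[OF K ab(1)])
  have "flip_colors (pverts G - {a}) (flip_colors {a} (flip_colors (pverts G - {a}) \<beta>)) =
      flip_colors {a} \<beta>"
    by (auto simp: flip_colors_def)
  then show ?thesis
    by (simp add: local_inversions_def local_inversion_def center leaf
        local_complement_at_leaf[OF leaf] open_nbhd_complete[OF K ab(1)])
qed

text \<open>
  Distinctness of the list matters because a vertex that is treated twice gets its original color back.
\<close>

lemma reverse_colors_one_by_one:
  assumes K: "K\<^bsub>n\<^esub> (with_proj G)"
    and other: "\<And>a. a \<in> pverts G \<Longrightarrow> f a \<in> pverts G \<and> f a \<noteq> a"
    and "distinct as" and "set as \<subseteq> pverts G"
  shows "local_inversions (G, \<beta>) (concat (map (\<lambda>a. [a, f a, a]) as)) =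
    (G, flip_colors (set as) \<beta>)"
  using assms(3,4)
proof (induction as arbitrary: \<beta>)
  case Nil
  then show ?case
    by (simp add: local_inversions_def flip_colors_def)
next
  case (Cons a as)
  let ?w = "concat (map (\<lambda>a. [a, f a, a]) as)"
  have single: "local_inversions (G, \<beta>) [a, f a, a] = (G, flip_colors {a} \<beta>)"
    by (rule flip_single_color[OF K]) (use Cons.prems other[of a] in auto)
  have "local_inversions (G, \<beta>) ([a, f a, a] @ ?w) =
      (G, flip_colors (set as) (flip_colors {a} \<beta>))"
    using Cons unfolding local_inversions_append single by simp
  also have "flip_colors (set as) (flip_colors {a} \<beta>) = flip_colors (set (a # as)) \<beta>"
  proof -
    have "(set as - {a}) \<union> ({a} - set as) = set (a # as)"
      using Cons.prems by auto
    then show ?thesis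
      by (simp only: flip_colors_flip_colors)
  qed
  finally show ?case
    by simp
qed

theorem theorem4:
  fixes n :: nat and G :: "'a pair_pre_digraph"
  assumes "n \<ge> 2" and "K\<^bsub>n\<^esub> (with_proj G)"
  shows "color_reversal_number G \<le> enat (3 * n)"
proof -
  have card: "card (pverts G) = n"
    using assms(2) by (simp add: complete_digraph_def)
  then have fin: "finite (pverts G)"
    using assms(1) by (intro card_ge_0_finite) simp
  have "\<exists>b. b \<in> pverts G \<and> b \<noteq> a" if "a \<in> pverts G" for a
  proof -
    have "card (pverts G - {a}) \<noteq> 0"
      using that card assms(1) by (simp add: fin)
    then have "pverts G - {a} \<noteq> {}"
      by (metis card.empty)
    then show ?thesis
      by blast
  qed
  then obtain f where f: "\<And>a. a \<in> pverts G \<Longrightarrow> f a \<in> pverts G \<and> f a \<noteq> a"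
    by metis
  obtain as where as: "set as = pverts G" "distinct as"
    using finite_distinct_list[OF fin] by blast
  let ?w = "concat (map (\<lambda>a. [a, f a, a]) as)"
  have "length ?w = 3 * length as"
    by (induction as) auto
  then have "length ?w \<le> 3 * n"
    using as card distinct_card[of as] by simp
  moreover have "?w \<in> lists (pverts G)"
    using as f by auto
  moreover have "local_inversions (G, \<beta>) ?w = color_flip (G, \<beta>) (pverts G)" for \<beta>
    using reverse_colors_one_by_one[OF assms(2) f as(2), of \<beta>] as(1)
    by (simp add: color_flip_def)
  ultimately have "reverses_within G (3 * n)"
    unfolding reverses_within_def by blast
  then show ?thesis
    by (simp only: color_reversal_number_le_iff)
qed

end
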